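(* Let $R$ be an associative ring, let $I$ be a nonzero (two-sided) ideal of $R$, and let $T$ be a semiprime ideal of $R$ such that $T\subsetneq I$. Assume that $\mathrm{char}(R/T)\neq 2$, in the sense that $R/T$ is $2$-torsion free (for $a\in R$, $2a\in T$ implies $a\in T$). Let $d:R\to R$ be a derivation such that $d(x)[d(x),x]\in T$ for all $x\in I$. Then $d$ is $T$-commuting on $I$, i.e. $[d(x),x]\in T$ for all $x\in I$.
   Context: Rings are associative and not assumed to be unital or commutative. $[x,y]=xy-yx$. A two-sided ideal $T$ of $R$ is semiprime if, for $a\in R$, $aRa\subseteq T$ implies $a\in T$. A derivation of $R$ is an additive map $d:R\to R$ with $d(xy)=d(x)y+xd(y)$ for all $x,y\in R$; it is not assumed that $d(T)\subseteq T$ or $d(I)\subseteq I$. For a nonempty subset $K\subseteq R$, $d$ is called $T$-commuting on $K$ if $[d(x),x]\in T$ for all $x\in K$. *)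

theory Defs
  imports Complex_Main
begin

text \<open>
  The type class \<^class>\<open>ring\<close> consists of associative rings that need not be unital or
  commutative; a ring \<open>R\<close> is modelled by a type of this class.
\<close>

definition commutator :: "'a::ring \<Rightarrow> 'a \<Rightarrow> 'a" where
  "commutator x y = x * y - y * x"

definition two_sided_ideal :: "'a::ring set \<Rightarrow> bool" where
  "two_sided_ideal J \<longleftrightarrow>
     0 \<in> J \<and> (\<forall>x\<in>J. \<forall>y\<in>J. x - y \<in> J) \<and> (\<forall>x\<in>J. \<forall>r. r * x \<in> J \<and> x * r \<in> J)"

definition semiprime_ideal :: "'a::ring set \<Rightarrow> bool" where
  "semiprime_ideal T \<longleftrightarrow>
     two_sided_ideal T \<and> (\<forall>a. (\<forall>r. a * r * a \<in> T) \<longrightarrow> a \<in> T)"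

text \<open>
  \<open>R/T\<close> is 2-torsion free, expressed on representatives. Without a unit there is no numeral 2
  in \<open>R\<close>; \<open>2a\<close> is the sum \<open>a + a\<close>.
\<close>

definition quotient_two_torsion_free :: "'a::ring set \<Rightarrow> bool" where
  "quotient_two_torsion_free T \<longleftrightarrow> (\<forall>a. a + a \<in> T \<longrightarrow> a \<in> T)"

definition derivation :: "('a::ring \<Rightarrow> 'a) \<Rightarrow> bool" where
  "derivation d \<longleftrightarrow> additive d \<and> (\<forall>x y. d (x * y) = d x * y + x * d y)"

definition commuting_modulo_on :: "'a::ring set \<Rightarrow> ('a \<Rightarrow> 'a) \<Rightarrow> 'a set \<Rightarrow> bool" where
  "commuting_modulo_on T d K \<longleftrightarrow> (\<forall>x\<in>K. commutator (d x) x \<in> T)"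

end

theory Submission
  imports Defs
begin

text \<open>
  Work modulo \<open>T\<close>, write \<open>[x, y] = xy - yx\<close>, fix \<open>x \<in> I\<close> and put \<open>a = d x\<close>, \<open>c = [a, x]\<close>,
  \<open>v = [x, c]\<close>, \<open>p = ax + c\<close>. Linearizing \<open>a c = 0\<close> and comparing the results for \<open>y\<close>, \<open>y x\<close> and
  \<open>z y\<close> gives \<open>d z y v + [a, z] y p + [z, ax] y a = 0\<close> for \<open>y \<in> I\<close> and all \<open>z\<close>, in particular
  \<open>a y v + c y p = c x y a\<close>. The latter behaves like a linear dependence between \<open>v\<close>, \<open>p\<close>, \<open>a\<close>;
  elimination yields \<open>c\<^sup>2 = 0\<close> and \<open>v y a = a y v\<close>, and then \<open>(d z y v - [z, c] y a) r c = 0\<close>.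
  So \<open>d\<close> acts like an inner derivation by a multiple of the square-zero element \<open>c\<close>.
  The hypothesis at \<open>z\<close> then makes products \<open>c z c z c z c\<close> vanish after multiplication by an element
  built from \<open>a r c\<close>, and in a semiprime ring \<open>(h t)\<^sup>3 h = 0\<close> for all \<open>t\<close> forces \<open>h = 0\<close>.
\<close>

section \<open>Nil elements modulo a semiprime ideal\<close>

locale semiprime_mod =
  fixes T :: "'a::ring set"
  assumes semiprime: "semiprime_ideal T"
    and two_free: "quotient_two_torsion_free T"
begin

lemma ideal: "two_sided_ideal T"
  using semiprime unfolding semiprime_ideal_def by blast

lemma diff_mem [intro]: "x \<in> T \<Longrightarrow> y \<in> T \<Longrightarrow> x - y \<in> T"
  using ideal by (simp add: two_sided_ideal_def)

lemma zero_mem [simp]: "0 \<in> T"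
  using ideal by (simp add: two_sided_ideal_def)

lemma uminus_mem [intro]: "x \<in> T \<Longrightarrow> - x \<in> T"
  using diff_mem [of 0 x] by simp

lemma add_mem [intro]: "x \<in> T \<Longrightarrow> y \<in> T \<Longrightarrow> x + y \<in> T"
  using diff_mem [of x "- y"] by auto

lemma mult_mem [intro]: "x \<in> T \<Longrightarrow> r * x \<in> T" "x \<in> T \<Longrightarrow> x * r \<in> T"
  using ideal by (auto simp: two_sided_ideal_def)

lemma double_memD: "x + x \<in> T \<Longrightarrow> x \<in> T"
  using two_free unfolding quotient_two_torsion_free_def by blast

lemma semiprimeD: "(\<And>r. x * r * x \<in> T) \<Longrightarrow> x \<in> T"
  using semiprime unfolding semiprime_ideal_def by blast

text \<open>Linearizing in \<open>t\<close> leaves \<open>h*t*h*s*h + h*s*h*t*h\<close> in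
  \<open>T\<close>; left multiplication by \<open>h * t\<close> turns the first summand into a
  multiple of \<open>f t\<close>.\<close>

lemma nil_index_three_mem:
  assumes "\<And>t. h * t * h * t * h \<in> T"
  shows "h \<in> T"
proof (rule semiprimeD)
  define f where "f t = h * t * h * t * h" for t
  have f: "f t \<in> T" for t
    using assms by (simp add: f_def)
  fix t
  show "h * t * h \<in> T"
  proof (rule semiprimeD)
    fix s
    have "h * t * h * s * (h * t * h) = h * t * (f (t + s) - f t - f s) - f t * s * h"
      by (simp add: f_def algebra_simps)
    also have "\<dots> \<in> T"
      by (intro diff_mem) (blast intro: f)+
    finally show "h * t * h * s * (h * t * h) \<in> T" .
  qed
qed

lemma nil_index_four_mem:
  assumes "\<And>t. h * t * h * t * h * t * h \<in> T"
  shows "h \<in> T"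
proof (rule nil_index_three_mem)
  define f where "f t = h * t * h * t * h * t * h" for t
  have f: "f t \<in> T" for t
    using assms by (simp add: f_def)
  fix t
  show "h * t * h * t * h \<in> T"
  proof (rule semiprimeD)
    fix s
    \<comment> \<open>The part of \<open>f (t + s)\<close> linear in \<open>s\<close>; subtracting
      \<open>f (t - s)\<close> leaves twice this part and twice the cubic part
      \<open>f s\<close>.\<close>
    define g where
      "g = h * t * h * t * h * s * h + h * t * h * s * h * t * h + h * s * h * t * h * t * h"
    have "g + g = f (t + s) - f (t - s) - f s - f s"
      by (simp add: f_def g_def algebra_simps)
    also have "\<dots> \<in> T"
      by (intro diff_mem f)
    finally have g: "g \<in> T"
      by (rule double_memD)
    have "h * t * h * t * h * s * (h * t * h * t * h) =
        h * t * h * t * g - f t * t * h * s * h - f t * s * h * t * h"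
      by (simp add: f_def g_def algebra_simps)
    also have "\<dots> \<in> T"
      by (intro diff_mem) (blast intro: f g)+
    finally show "h * t * h * t * h * s * (h * t * h * t * h) \<in> T" .
  qed
qed

end

section \<open>Annihilators tested only on the ideal \<open>I\<close>\<close>

locale semiprime_mod_ideal = semiprime_mod T for T :: "'a::ring set" +
  fixes I :: "'a set"
  assumes ideal_I: "two_sided_ideal I"
begin

lemma diff_I [intro]: "x \<in> I \<Longrightarrow> y \<in> I \<Longrightarrow> x - y \<in> I"
  using ideal_I by (simp add: two_sided_ideal_def)

lemma add_I [intro]: "x \<in> I \<Longrightarrow> y \<in> I \<Longrightarrow> x + y \<in> I"
  using diff_I [of x "0 - y"] diff_I [of 0 y] ideal_I by (simp add: two_sided_ideal_def)

lemma mult_I [intro]: "x \<in> I \<Longrightarrow> r * x \<in> I" "x \<in> I \<Longrightarrow> x * r \<in> I"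
  using ideal_I by (auto simp: two_sided_ideal_def)

lemma annihilator_right:
  assumes "u \<in> I \<or> v \<in> I" and uv: "\<And>y. y \<in> I \<Longrightarrow> u * y * v \<in> T"
  shows "u * r * v \<in> T"
proof (rule semiprimeD)
  fix s
  \<comment> \<open>The middle factor contains both \<open>u\<close> and \<open>v\<close>, hence
    lies in \<open>I\<close>.\<close>
  have "u * (r * v * s * u * r) * v \<in> T"
    using assms(1) by (intro uv) (auto simp: mult.assoc)
  then show "u * r * v * s * (u * r * v) \<in> T"
    by (simp add: mult.assoc)
qed

lemma annihilator_left:
  assumes "u \<in> I \<or> v \<in> I" and "\<And>y. y \<in> I \<Longrightarrow> u * y * v \<in> T"
  shows "v * r * u \<in> T"
proof (rule semiprimeD)
  fix s
  have "v * r * (u * s * v) * r * u \<in> T"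
    using annihilator_right [OF assms] by (blast intro: mult_mem)
  then show "v * r * u * s * (v * r * u) \<in> T"
    by (simp add: mult.assoc)
qed

lemma semiprimeD_ideal:
  assumes "w \<in> I" and "\<And>y. y \<in> I \<Longrightarrow> w * y * w \<in> T"
  shows "w \<in> T"
  using assms annihilator_right [of w w] by (blast intro: semiprimeD)

end

section \<open>Linearizing the hypothesis on the derivation\<close>

locale semiprime_mod_derivation = semiprime_mod_ideal T I for T I :: "'a::ring set" +
  fixes d :: "'a \<Rightarrow> 'a"
  assumes deriv: "derivation d"
    and d_comm: "\<And>x. x \<in> I \<Longrightarrow> d x * (d x * x - x * d x) \<in> T"
begin

lemma d_mult: "d (x * y) = d x * y + x * d y"
  using deriv by (simp add: derivation_def)

lemma d_add: "d (x + y) = d x + d y"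
  using deriv by (simp add: derivation_def additive.add)

lemma d_diff: "d (x - y) = d x - d y"
  using deriv by (simp add: derivation_def additive.diff)

lemma linearized:
  assumes x: "x \<in> I" and y: "y \<in> I"
  shows "d y * (d x * x - x * d x) + d x * (d y * x - x * d y) + d x * (d x * y - y * d x) \<in> T"
    (is "?g \<in> T")
proof -
  let ?f = "\<lambda>x. d x * (d x * x - x * d x)"
  have "?g + ?g = ?f (x + y) - ?f (x - y) - ?f y - ?f y"
    by (simp add: algebra_simps d_add d_diff)
  also have "\<dots> \<in> T"
    using x y by (intro diff_mem d_comm add_I diff_I)
  finally show ?thesis
    by (rule double_memD)
qed

context
  fixes x a c v p :: 'a
  assumes x: "x \<in> I"
  defines a: "a \<equiv> d x"
    and c: "c \<equiv> a * x - x * a"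
    and v: "v \<equiv> x * c - c * x"
    and p: "p \<equiv> a * x + c"
begin

lemma c_I: "c \<in> I"
  using x by (auto simp: c)

lemma v_I: "v \<in> I"
  using x c_I by (auto simp: v)

lemma a_c: "a * c \<in> T"
  using d_comm [OF x] by (simp add: a c)

text \<open>Comparing \<open>y * x\<close> with \<open>y\<close> cancels \<open>[d y, x]\<close>, so
  \<open>d y\<close> survives only as a left factor of \<open>v\<close>.\<close>

lemma relation_y:
  assumes y: "y \<in> I"
  shows "d y * v + a * (y * x - x * y) * a + a * y * c + a * y * c \<in> T"
proof -
  define A where "A y = d y * (d x * x - x * d x) + d x * (d y * x - x * d y)
    + d x * (d x * y - y * d x)" for y
  have A: "A y \<in> T" if "y \<in> I" for y
    using linearized [OF x that] by (simp add: A_def)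
  have "d y * v + a * (y * x - x * y) * a + a * y * c + a * y * c
      = A (y * x) - A y * x - y * (a * c)"
    unfolding A_def v c a by (simp add: algebra_simps d_mult)
  also have "\<dots> \<in> T"
    using y by (intro diff_mem) (blast intro: A a_c)+
  finally show ?thesis .
qed

text \<open>Comparing \<open>z * y\<close> with \<open>y\<close> cancels \<open>d y\<close> and
  leaves \<open>d z\<close>; the factor \<open>p\<close> arises as
  \<open>x * a + c + c\<close>.\<close>

lemma relation_zy:
  assumes y: "y \<in> I"
  shows "d z * y * v + (a * z - z * a) * y * p + (z * (a * x) - a * x * z) * y * a \<in> T"
proof -
  define B where "B y = d y * v + a * (y * x - x * y) * a + a * y * c + a * y * c" for y
  have B: "B y \<in> T" if "y \<in> I" for y
    using relation_y [OF that] by (simp add: B_def)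
  have "d z * y * v + (a * z - z * a) * y * p + (z * (a * x) - a * x * z) * y * a
      = B (z * y) - z * B y"
    unfolding B_def p c by (simp add: algebra_simps d_mult)
  also have "\<dots> \<in> T"
    using y by (intro diff_mem) (blast intro: B)+
  finally show ?thesis .
qed

lemma relation_x:
  assumes y: "y \<in> I"
  shows "a * y * v + c * y * p - c * x * y * a \<in> T"
proof -
  have "a * y * v + c * y * p - c * x * y * a
      = d x * y * v + (a * x - x * a) * y * p + (x * (a * x) - a * x * x) * y * a"
    unfolding c a by (simp add: algebra_simps)
  then show ?thesis
    using relation_zy [OF y, of x] by simp
qed

lemma c_square: "c * c \<in> T"
proof (rule semiprimeD_ideal)
  show "c * c \<in> I"
    using c_I by auto
  define E where "E y = a * y * v + c * y * p - c * x * y * a" for y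
  have E: "E y \<in> T" if "y \<in> I" for y
    using relation_x [OF that] by (simp add: E_def)
  \<comment> \<open>As \<open>a * c\<close> vanishes modulo \<open>T\<close>, \<open>a * v\<close>
    is congruent to \<open>c * c\<close>, so the \<open>c * c\<close> terms of the two multiples of
    \<open>E\<close> cancel.\<close>
  have cayv: "c * a * y * v \<in> T" if y: "y \<in> I" for y
  proof -
    let ?q = "y * x * a + y * c + y * c - x * y * a"
    have "c * a * y * v = c * E y + a * (E (x * y) - x * E y)
        - a * c * y * v - (a * c * x - x * (a * c)) * ?q"
      unfolding E_def p v c by (simp add: algebra_simps)
    also have "\<dots> \<in> T"
      using y by (intro diff_mem add_mem) (blast intro: E a_c)+
    finally show ?thesis .
  qed
  fix y
  assume y: "y \<in> I"
  \<comment> \<open>Modulo \<open>T\<close>, \<open>p * c\<close> is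
    \<open>c * c + c * c\<close>.\<close>
  have "c * c * y * (c * c) + c * c * y * (c * c) =
     c * E y * c - c * a * y * v * c - c * c * (y * x - x * y) * (a * c)"
    unfolding E_def p c by (simp add: algebra_simps)
  also have "\<dots> \<in> T"
    using y by (intro diff_mem) (blast intro: E a_c cayv)+
  finally show "c * c * y * (c * c) \<in> T"
    by (rule double_memD)
qed

text \<open>
  \<open>k s\<close> is the minor obtained by eliminating \<open>p\<close> from two instances of \<open>relation_x\<close>; it annihilates
  every \<open>V y\<close>, while bracketing \<open>k\<close> with \<open>x\<close> on either side of its argument recovers \<open>V\<close>.
\<close>

lemma v_a_symmetric:
  assumes y: "y \<in> I"
  shows "v * y * a - a * y * v \<in> T"
proof -
  define V where "V y = v * y * a - a * y * v" for y
  define k where "k s = a * s * c - c * s * a" for s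
  define E where "E y = a * y * v + c * y * p - c * x * y * a" for y
  have E: "E y \<in> T" if "y \<in> I" for y
    using relation_x [OF that] by (simp add: E_def)
  let ?n = "\<lambda>s. c * x * s * c - c * s * (c * x)"
  have V_I: "V y \<in> I" for y
    using v_I by (auto simp: V_def)
  have k_I: "k s \<in> I" for s
    using c_I by (auto simp: k_def)
  have kv: "k s * t * v - ?n s * t * a \<in> T" if "s \<in> I" "t \<in> I" for s t
  proof -
    have "k s * t * v - ?n s * t * a = E (s * c * t) - c * s * E t"
      unfolding E_def k_def by (simp add: algebra_simps)
    also have "\<dots> \<in> T"
      using that by (intro diff_mem) (blast intro: E)+
    finally show ?thesis .
  qed
  \<comment> \<open>Using \<open>kv\<close> at \<open>t\<close> and at \<open>t * a * y\<close>
    produces the same \<open>?n\<close> term, which cancels.\<close>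
  have kV: "k s * t * V y \<in> T" if "s \<in> I" "t \<in> I" for s t y
  proof -
    have "k s * t * V y = (k s * t * v - ?n s * t * a) * y * a
        - (k s * (t * a * y) * v - ?n s * (t * a * y) * a)"
      unfolding V_def by (simp add: algebra_simps)
    also have "\<dots> \<in> T"
      using that by (intro diff_mem [OF mult_mem(2) [OF mult_mem(2)]] kv mult_I)
    finally show ?thesis .
  qed
  have Vk: "V y * r * k s \<in> T" if "s \<in> I" for s r y
    by (rule annihilator_left) (use k_I kV that in blast)+
  have "V y * r * V y \<in> T" for r
  proof -
    have "V y * r * V y =
        V y * r * k (x * y) - V y * (r * x) * k y - V y * r * k (y * x) + V y * r * k y * x"
      unfolding k_def V_def v c by (simp add: algebra_simps)
    also have "\<dots> \<in> T"
      using y by (intro diff_mem add_mem) (blast intro: Vk)+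
    finally show ?thesis .
  qed
  then have "V y \<in> T"
    by (rule semiprimeD)
  then show ?thesis
    by (simp add: V_def)
qed

lemma d_inner:
  assumes y: "y \<in> I"
  shows "d z * y * v * r * c - (z * c - c * z) * y * a * r * c \<in> T"
proof -
  define Q where "Q s = a * s * p - p * s * a" for s
  define E where "E y = a * y * v + c * y * p - c * x * y * a" for y
  have E: "E y \<in> T" if "y \<in> I" for y
    using relation_x [OF that] by (simp add: E_def)
  \<comment> \<open>The \<open>c * x\<close> terms of the two relations cancel, and symmetry of
    \<open>v\<close> and \<open>a\<close> removes the \<open>v\<close> terms.\<close>
  have cQ: "c * t * Q s \<in> T" if "s \<in> I" "t \<in> I" for s t
  proof -
    have "c * t * Q s = E (t * a * s) - E t * s * a + a * t * (v * s * a - a * s * v)"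
      unfolding E_def Q_def by (simp add: algebra_simps)
    also have "\<dots> \<in> T"
      using that by (intro diff_mem add_mem [OF diff_mem]) (blast intro: E v_a_symmetric)+
    finally show ?thesis .
  qed
  have Qc: "Q s * r * c \<in> T" if "s \<in> I" for s r
    by (rule annihilator_left) (use c_I cQ that in blast)+
  define D where
    "D = d z * y * v + (a * z - z * a) * y * p + (z * (a * x) - a * x * z) * y * a"
  have D: "D \<in> T"
    using relation_zy [OF y] by (simp add: D_def)
  \<comment> \<open>Before \<open>r * c\<close>, \<open>Q\<close> allows
    \<open>[a, z] * y * p\<close> to be replaced by \<open>[p, z] * y * a\<close>; since
    \<open>p - a * x = c\<close>, only \<open>[c, z]\<close> remains.\<close>
  have "d z * y * v * r * c - (z * c - c * z) * y * a * r * c =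
     D * r * c + z * (Q y * r * c) - Q (z * y) * r * c"
    unfolding D_def Q_def p by (simp add: algebra_simps)
  also have "\<dots> \<in> T"
    using y by (intro diff_mem add_mem) (blast intro: D Qc)+
  finally show ?thesis .
qed

lemma nil_relation:
  assumes z: "z \<in> I" and y: "y \<in> I" and y': "y' \<in> I"
  shows "c * z * c * z * c * z * c * y * (a * r * c * y' * a * r * c) \<in> T"
proof -
  define X where "X y = d z * y * v * r * c - (z * c - c * z) * y * a * r * c" for y
  have X: "X y \<in> T" if "y \<in> I" for y
    using d_inner [OF that] by (simp add: X_def)
  define F where "F = d z * (d z * z - z * d z)"
  have F: "F \<in> T"
    using d_comm [OF z] by (simp add: F_def)
  let ?b = "z * c - c * z"
  let ?bz = "?b * z - z * ?b"
  let ?G = "a * r * c * y' * a * r * c"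
  let ?h = "c * z * c * z * c * z * c * y * ?G"
  \<comment> \<open>Each of the two \<open>d z\<close> in a term of \<open>F\<close> becomes
    \<open>?b\<close> at the cost of one factor \<open>v\<close>, which turns into
    \<open>a\<close>.\<close>
  have bracket: "?b * ?bz * w * ?G \<in> T" if w: "w \<in> I" for w
  proof -
    have "?b * ?bz * w * ?G =
       F * (w * v * r * c * y' * v * r * c)
       - (d z * X (z * w) - d z * z * X w) * y' * v * r * c
       - X (?bz * w * a * r * c * y')"
      by (simp add: F_def X_def algebra_simps)
    also have "\<dots> \<in> T"
      using w y' by (intro diff_mem) (blast intro: F X)+
    finally show ?thesis .
  qed
  \<comment> \<open>With \<open>c * c\<close> in \<open>T\<close>, only the summand
    \<open>z*c*z + z*c*z\<close> of \<open>?bz\<close> survives between \<open>c * ?b\<close> and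
    \<open>c\<close>.\<close>
  have "?h + ?h = c * (?b * ?bz * (c * y) * ?G)
      + c * c * z * ?bz * c * y * ?G
      + c * z * (c * c) * z * z * c * y * ?G
      + c * z * c * z * z * (c * c) * y * ?G"
    by (simp add: algebra_simps)
  also have "\<dots> \<in> T"
    using y by (intro add_mem) (blast intro: c_square bracket)+
  finally show ?thesis
    by (rule double_memD)
qed

lemma c_mem: "c \<in> T"
proof -
  have ac: "a * r * c \<in> T" for r
  proof (rule semiprimeD_ideal)
    let ?k = "a * r * c"
    show k_I: "?k \<in> I"
      using c_I by auto
    fix y
    assume y: "y \<in> I"
    show "?k * y * ?k \<in> T"
    proof (rule semiprimeD_ideal)
      show "?k * y * ?k \<in> I"
        using y by auto
      fix y'
      assume y': "y' \<in> I"
      define h where "h = c * y * (?k * y' * ?k)"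
      have "h * t * h * t * h * t * h \<in> T" for t
      proof -
        \<comment> \<open>This is \<open>nil_relation\<close> with
          \<open>z = y * (?k * y' * ?k) * t\<close>.\<close>
        have "h * t * h * t * h * t * h =
          c * (y * (?k * y' * ?k) * t) * c * (y * (?k * y' * ?k) * t) * c
            * (y * (?k * y' * ?k) * t) * c * y * (a * r * c * y' * a * r * c)"
          by (simp add: h_def mult.assoc)
        also have "\<dots> \<in> T"
          using y y' by (intro nil_relation mult_I)
        finally show ?thesis .
      qed
      then have "h \<in> T"
        by (rule nil_index_four_mem)
      then have "a * r * h * y * ?k \<in> T"
        by (intro mult_mem)
      then show "?k * y * ?k * y' * (?k * y * ?k) \<in> T"
        by (simp add: h_def mult.assoc)
    qed
  qed
  show ?thesis
  proof (rule semiprimeD)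
    fix r
    have "c * r * c = a * (x * r) * c - x * (a * r * c)"
      unfolding c by (simp add: algebra_simps)
    also have "\<dots> \<in> T"
      by (intro diff_mem mult_mem(1) ac)
    finally show "c * r * c \<in> T" .
  qed
qed

end

end

theorem theorem2p11:
  fixes I T :: "'a::ring set" and d :: "'a \<Rightarrow> 'a"
  assumes "two_sided_ideal I" and "I \<noteq> {0}"
    and "semiprime_ideal T" and "T \<subset> I"
    and "quotient_two_torsion_free T"
    and "derivation d"
    and "\<And>x. x \<in> I \<Longrightarrow> d x * commutator (d x) x \<in> T"
  shows "commuting_modulo_on T d I"
proof -
  interpret semiprime_mod_derivation T I d
    using assms by unfold_locales (simp_all add: commutator_def)
  show ?thesis
    using c_mem by (simp add: commuting_modulo_on_def commutator_def)
qed

end
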